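(* For any integer $p \ge 0$ and any real $\nu \in [0,1]$, the Hölder constant of $D^p f_{p+\nu}$ corresponding to degree $\nu$, where $f_{p+\nu}(x) := \|x\|^{p+\nu}$ for $x \in \mathbb{E}$, cannot be smaller than $$C_{p,\nu} := \begin{cases} \prod_{i=1}^p (\nu+i), & \text{if } p \text{ is even},\\ 2^{1-\nu}\prod_{i=1}^p (\nu+i), & \text{if } p \text{ is odd}.\end{cases}$$ That is, if a real number $A$ satisfies $\|D^p f_{p+\nu}(x_2) - D^p f_{p+\nu}(x_1)\| \le A\|x_2-x_1\|^\nu$ for all $x_1,x_2 \in \mathbb{E}$, then $A \ge C_{p,\nu}$.
   Context: $\mathbb{E}$ is a finite-dimensional real vector space with dual space $\mathbb{E}^*$; $\langle s, x\rangle$ denotes the value of $s \in \mathbb{E}^*$ at $x \in \mathbb{E}$. A self-adjoint positive definite operator $B : \mathbb{E} \to \mathbb{E}^*$ is fixed, and $\|x\| := \langle Bx, x\rangle^{1/2}$. $D^p f$ denotes the $p$-th derivative of $f$ (with $D^0 f = f$); $D^p f(x)$ is a symmetric $p$-multilinear form on $\mathbb{E}$. The norm of a $p$-multilinear form $L$ is $\|L\| := \max_{\|h_1\|=\dots=\|h_p\|=1} |L[h_1,\dots,h_p]|$ (the absolute value when $p=0$). Empty products equal $1$.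
   Formalization: The case ν = 0 with p even, p ≥ 2 is excluded: there ‖x‖^p is a polynomial of degree p, so D^p f_p is constant and A = 0 works although C = p! > 0. E is nontrivial; for p = ν = 0, 0^0 is read as 0; for ν = 0 and p odd, x1 and x2 are nonzero. *)

theory Defs
  imports "HOL-Analysis.Analysis"
begin

text \<open>
  The space is a type of class \<open>euclidean_space\<close>, used only as a finite-dimensional real vector
  space (of dimension at least 1) with its canonical topology; the norm and inner product
  of the class play no role. The dual space is the type \<open>'a \<Rightarrow>\<^sub>L real\<close>.
\<close>

definition selfadjoint_posdef :: "('a::euclidean_space \<Rightarrow> ('a \<Rightarrow>\<^sub>L real)) \<Rightarrow> bool" where
  "selfadjoint_posdef B \<longleftrightarrow>
     linear B \<and>
     (\<forall>x y. blinfun_apply (B x) y = blinfun_apply (B y) x) \<and>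
     (\<forall>x. x \<noteq> 0 \<longrightarrow> blinfun_apply (B x) x > 0)"

definition normB :: "('a::euclidean_space \<Rightarrow> ('a \<Rightarrow>\<^sub>L real)) \<Rightarrow> 'a \<Rightarrow> real" where
  "normB B x = sqrt (blinfun_apply (B x) x)"

text \<open>
  A \<open>p\<close>-multilinear form is represented by its values on lists of length \<open>p\<close>.
  \<open>Dform f x [h\<^sub>1, \<dots>, h\<^sub>p]\<close> is the value of the \<open>p\<close>-th derivative of \<open>f\<close> at \<open>x\<close>
  on \<open>h\<^sub>1, \<dots>, h\<^sub>p\<close>. In finite dimension the Frechet derivative of a form-valued map
  is the derivative of its evaluations, so each step differentiates
  the evaluation at the remaining arguments.
\<close>

primrec Dform :: "('a::euclidean_space \<Rightarrow> real) \<Rightarrow> 'a \<Rightarrow> 'a list \<Rightarrow> real" where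
  "Dform f x [] = f x"
| "Dform f x (h # hs) = frechet_derivative (\<lambda>y. Dform f y hs) (at x) h"

text \<open>
  Existence of the \<open>p\<close>-th derivative at \<open>x\<close>; without it the value of \<open>Dform\<close>
  on lists of length \<open>p\<close> is meaningless.
\<close>

primrec times_differentiable_at :: "nat \<Rightarrow> ('a::euclidean_space \<Rightarrow> real) \<Rightarrow> 'a \<Rightarrow> bool" where
  "times_differentiable_at 0 f x \<longleftrightarrow> True"
| "times_differentiable_at (Suc p) f x \<longleftrightarrow>
     (\<forall>\<^sub>F y in nhds x. times_differentiable_at p f y) \<and>
     (\<forall>hs. length hs = p \<longrightarrow> (\<lambda>y. Dform f y hs) differentiable (at x))"

text \<open>
  The supremum is a maximum for multilinear forms, by compactness of the unit sphere.
  For \<open>p = 0\<close> only the empty list qualifies, giving the absolute value.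
\<close>

definition form_norm ::
  "('a::euclidean_space \<Rightarrow> ('a \<Rightarrow>\<^sub>L real)) \<Rightarrow> nat \<Rightarrow> ('a list \<Rightarrow> real) \<Rightarrow> real" where
  "form_norm B p L =
     Sup {\<bar>L hs\<bar> | hs. length hs = p \<and> (\<forall>h\<in>set hs. normB B h = 1)}"

text \<open>
  Note \<open>0 powr 0 = 0\<close>: for \<open>q = 0\<close> this function is 0 at the origin and 1 elsewhere.
\<close>

definition power_norm :: "('a::euclidean_space \<Rightarrow> ('a \<Rightarrow>\<^sub>L real)) \<Rightarrow> real \<Rightarrow> 'a \<Rightarrow> real" where
  "power_norm B q x = normB B x powr q"

text \<open>
  \<open>A\<close> is a Hoelder bound of degree \<open>\<nu>\<close> for the \<open>p\<close>-th derivative of \<open>f\<close>, tested at all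
  points where that derivative exists. For \<open>f = power_norm B (p + \<nu>)\<close> these are all points,
  except that the origin drops out when \<open>\<nu> = 0\<close> and \<open>p\<close> is odd.
\<close>

definition holder_bound ::
  "('a::euclidean_space \<Rightarrow> ('a \<Rightarrow>\<^sub>L real)) \<Rightarrow> nat \<Rightarrow> real \<Rightarrow> ('a \<Rightarrow> real) \<Rightarrow> real \<Rightarrow> bool" where
  "holder_bound B p \<nu> f A \<longleftrightarrow>
     (\<forall>x1 x2. times_differentiable_at p f x1 \<longrightarrow> times_differentiable_at p f x2 \<longrightarrow>
        form_norm B p (\<lambda>hs. Dform f x2 hs - Dform f x1 hs)
          \<le> A * normB B (x2 - x1) powr \<nu>)"

definition C_const :: "nat \<Rightarrow> real \<Rightarrow> real" where
  "C_const p \<nu> =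
     (if even p then (\<Prod>i=1..p. (\<nu> + real i))
      else 2 powr (1 - \<nu>) * (\<Prod>i=1..p. (\<nu> + real i)))"

end

theory Submission
  imports Defs
begin

text \<open>
  Only the line through a unit vector \<open>e\<close> matters. With \<open>q = p + \<nu>\<close> and
  \<open>C = (\<nu> + 1) \<cdots> (\<nu> + p)\<close>, the restriction of \<open>f = \<parallel>x\<parallel>\<^sup>q\<close> to this line is
  \<open>\<bar>t\<bar>\<^sup>q\<close>, whose \<open>p\<close>-th derivative is \<open>C t\<^sup>\<nu>\<close> for \<open>t > 0\<close> and
  \<open>(-1)\<^sup>p C \<bar>t\<bar>\<^sup>\<nu>\<close> for \<open>t < 0\<close> (lemma \<open>Dform_power_norm_line\<close>).
  If \<open>p\<close> is odd, the points \<open>e\<close> and \<open>-e\<close> give \<open>2 C \<le> A 2\<^sup>\<nu>\<close>. If \<open>p\<close> is even, the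
  natural pair is \<open>0\<close> and \<open>e\<close>; replacing \<open>0\<close> by \<open>\<epsilon> e\<close> and letting \<open>\<epsilon>\<close> tend to \<open>0\<close> gives
  \<open>C \<le> A\<close> for \<open>\<nu> > 0\<close> from derivatives away from the origin alone.

  What makes this legitimate is that \<open>f\<close> is smooth away from the origin, and that its derivatives
  there are bounded on unit directions, so that the supremum in \<open>form_norm\<close>
  dominates the value on \<open>[e, \<dots>, e]\<close>. Both follow from the shape of the derivatives: the
  \<open>p\<close>-th derivative at \<open>y\<close> in directions \<open>h\<^sub>0, \<dots>, h\<^sub>p\<^sub>-\<^sub>1\<close> is a polynomial in the numbers
  \<open>\<langle>B y, h\<^sub>i\<rangle>\<close>, \<open>\<langle>B h\<^sub>i, h\<^sub>j\<rangle>\<close> and real powers of \<open>\<langle>B y, y\<rangle>\<close>. Such expressions are stable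
  under differentiation (lemma \<open>contraction_field_derivative\<close>) and bounded by the
  Cauchy-Schwarz inequality (lemma \<open>contraction_field_bounded\<close>).
\<close>

section \<open>The quadratic form of B\<close>

lemma posdef_nonneg:
  assumes "selfadjoint_posdef B"
  shows "blinfun_apply (B x) x \<ge> 0"
proof (cases "x = 0")
  case True
  with assms show ?thesis
    by (simp add: selfadjoint_posdef_def linear_0)
next
  case False
  with assms show ?thesis
    by (simp add: selfadjoint_posdef_def less_imp_le)
qed

lemma normB_scaleR:
  assumes "selfadjoint_posdef B"
  shows "normB B (c *\<^sub>R x) = \<bar>c\<bar> * normB B x"
  using assms
  by (simp add: normB_def selfadjoint_posdef_def linear_cmul blinfun.scaleR_left
      blinfun.scaleR_right real_sqrt_mult mult.assoc[symmetric])

lemma exists_unit_vector: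
  fixes B :: "'a::euclidean_space \<Rightarrow> ('a \<Rightarrow>\<^sub>L real)"
  assumes "selfadjoint_posdef B"
  obtains e where "normB B e = 1"
proof -
  obtain b :: 'a where "b \<in> Basis" using nonempty_Basis by blast
  then have "b \<noteq> 0" by (rule nonzero_Basis)
  with assms have "normB B b > 0"
    by (simp add: normB_def selfadjoint_posdef_def)
  then have "normB B ((1 / normB B b) *\<^sub>R b) = 1"
    using assms by (simp add: normB_scaleR)
  then show ?thesis by (rule that)
qed

text \<open>
  Cauchy-Schwarz: the form is nonnegative at \<open>y - \<langle>B y, h\<rangle> h\<close>, the component of \<open>y\<close> that is
  orthogonal to \<open>h\<close>.
\<close>

lemma abs_pairing_le_normB:
  assumes B: "selfadjoint_posdef B" and h: "normB B h = 1"
  shows "\<bar>blinfun_apply (B y) h\<bar> \<le> normB B y"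
proof -
  define t where "t = blinfun_apply (B y) h"
  have hh: "blinfun_apply (B h) h = 1" using h by (simp add: normB_def)
  have hy: "blinfun_apply (B h) y = t"
    using B by (simp add: t_def selfadjoint_posdef_def)
  have lin: "linear B" using B by (simp add: selfadjoint_posdef_def)
  have "0 \<le> blinfun_apply (B (y - t *\<^sub>R h)) (y - t *\<^sub>R h)"
    by (rule posdef_nonneg[OF B])
  also have "\<dots> = blinfun_apply (B y) y - t\<^sup>2"
    by (simp add: linear_diff[OF lin] linear_cmul[OF lin] blinfun.diff_left blinfun.diff_right
        blinfun.scaleR_left blinfun.scaleR_right hh hy t_def[symmetric] power2_eq_square)
  finally have "\<bar>t\<bar>\<^sup>2 \<le> blinfun_apply (B y) y" by simp
  then have "\<bar>t\<bar> \<le> sqrt (blinfun_apply (B y) y)" by (rule real_le_rsqrt)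
  then show ?thesis by (simp add: t_def normB_def)
qed

lemma has_derivative_pairing_left:
  fixes B :: "'a::euclidean_space \<Rightarrow> ('a \<Rightarrow>\<^sub>L real)"
  assumes "selfadjoint_posdef B"
  shows "((\<lambda>y. blinfun_apply (B y) k) has_derivative (\<lambda>h. blinfun_apply (B h) k)) (at y)"
proof -
  have "linear (\<lambda>y. blinfun_apply (B y) k)"
    using assms by (auto intro!: linearI simp: selfadjoint_posdef_def linear_add linear_cmul
        blinfun.add_left blinfun.scaleR_left)
  then show ?thesis by (rule linear_imp_has_derivative)
qed

lemma has_derivative_quadratic:
  fixes B :: "'a::euclidean_space \<Rightarrow> ('a \<Rightarrow>\<^sub>L real)"
  assumes B: "selfadjoint_posdef B"
  shows "((\<lambda>y. blinfun_apply (B y) y) has_derivative (\<lambda>h. 2 * blinfun_apply (B y) h)) (at y)"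
proof -
  have "linear B" using B by (simp add: selfadjoint_posdef_def)
  then have "(B has_derivative B) (at y)" by (rule linear_imp_has_derivative)
  from bounded_bilinear.FDERIV[OF bounded_bilinear_blinfun_apply this has_derivative_ident]
  have "((\<lambda>y. blinfun_apply (B y) y) has_derivative
      (\<lambda>h. blinfun_apply (B y) h + blinfun_apply (B h) y)) (at y)" .
  moreover have "blinfun_apply (B h) y = blinfun_apply (B y) h" for h
    using B by (simp add: selfadjoint_posdef_def)
  ultimately show ?thesis by simp
qed

section \<open>Smoothness away from the origin\<close>

text \<open>
  Expressions in a point \<open>y\<close> and directions \<open>k 0, \<dots>, k (p - 1)\<close>. The directions form a function
  on \<open>nat\<close>, not a list: putting a new direction in front is then \<open>case_nat h k\<close>, dropping it is
  composition with \<open>Suc\<close>, and no side conditions on lengths arise.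
\<close>

inductive contraction_field ::
  "('a::euclidean_space \<Rightarrow> ('a \<Rightarrow>\<^sub>L real)) \<Rightarrow> nat \<Rightarrow> ('a \<Rightarrow> (nat \<Rightarrow> 'a) \<Rightarrow> real) \<Rightarrow> bool"
  for B p where
  const: "contraction_field B p (\<lambda>y k. c)"
| power: "contraction_field B p (\<lambda>y k. blinfun_apply (B y) y powr s)"
| point: "i < p \<Longrightarrow> contraction_field B p (\<lambda>y k. blinfun_apply (B y) (k i))"
| pair: "i < p \<Longrightarrow> j < p \<Longrightarrow> contraction_field B p (\<lambda>y k. blinfun_apply (B (k i)) (k j))"
| add: "contraction_field B p F \<Longrightarrow> contraction_field B p G \<Longrightarrow>
    contraction_field B p (\<lambda>y k. F y k + G y k)"
| mult: "contraction_field B p F \<Longrightarrow> contraction_field B p G \<Longrightarrow>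
    contraction_field B p (\<lambda>y k. F y k * G y k)"

lemma contraction_field_shift:
  assumes "contraction_field B p F"
  shows "contraction_field B (Suc p) (\<lambda>y k. F y (\<lambda>i. k (Suc i)))"
  using assms by induction (auto intro: contraction_field.intros)

lemma contraction_field_derivative:
  fixes B :: "'a::euclidean_space \<Rightarrow> ('a \<Rightarrow>\<^sub>L real)"
  assumes B: "selfadjoint_posdef B" and "contraction_field B p F"
  shows "\<exists>F'. contraction_field B (Suc p) F' \<and>
    (\<forall>y k. y \<noteq> 0 \<longrightarrow> ((\<lambda>y. F y k) has_derivative (\<lambda>h. F' y (case_nat h k))) (at y))"
  using assms(2)
proof induction
  case (const c)
  show ?case
    by (rule exI[of _ "\<lambda>y k. 0"]) (auto intro: contraction_field.const)
next
  case (power s)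
  show ?case
  proof (intro exI[of _ "\<lambda>y k. (2 * s) * (blinfun_apply (B y) y powr (s - 1) * blinfun_apply (B y) (k 0))"]
      conjI allI impI)
    show "contraction_field B (Suc p)
      (\<lambda>y k. (2 * s) * (blinfun_apply (B y) y powr (s - 1) * blinfun_apply (B y) (k 0)))"
      by (intro contraction_field.intros) simp
  next
    fix y :: 'a and k :: "nat \<Rightarrow> 'a" assume "y \<noteq> 0"
    with B have "blinfun_apply (B y) y > 0" by (simp add: selfadjoint_posdef_def)
    from DERIV_compose_FDERIV[OF has_real_derivative_powr[OF this] has_derivative_quadratic[OF B]]
    show "((\<lambda>y. blinfun_apply (B y) y powr s) has_derivative
      (\<lambda>h. (2 * s) * (blinfun_apply (B y) y powr (s - 1) *
        blinfun_apply (B y) (case_nat h k 0)))) (at y)"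
      by (simp add: mult_ac)
  qed
next
  case (point i)
  then show ?case
    using has_derivative_pairing_left[OF B]
    by (intro exI[of _ "\<lambda>y k. blinfun_apply (B (k 0)) (k (Suc i))"])
      (auto intro: contraction_field.pair)
next
  case (pair i j)
  show ?case
    by (rule exI[of _ "\<lambda>y k. 0"]) (auto intro: contraction_field.const)
next
  case (add F G)
  then obtain F' G' where
    "contraction_field B (Suc p) F'" "contraction_field B (Suc p) G'"
    "\<And>y k. y \<noteq> 0 \<Longrightarrow> ((\<lambda>y. F y k) has_derivative (\<lambda>h. F' y (case_nat h k))) (at y)"
    "\<And>y k. y \<noteq> 0 \<Longrightarrow> ((\<lambda>y. G y k) has_derivative (\<lambda>h. G' y (case_nat h k))) (at y)"
    by blast
  then show ?case
    by (intro exI[of _ "\<lambda>y k. F' y k + G' y k"])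
      (auto intro: contraction_field.add has_derivative_add)
next
  case (mult F G)
  then obtain F' G' where
    F': "contraction_field B (Suc p) F'" and G': "contraction_field B (Suc p) G'" and
    dF: "\<And>y k. y \<noteq> 0 \<Longrightarrow> ((\<lambda>y. F y k) has_derivative (\<lambda>h. F' y (case_nat h k))) (at y)" and
    dG: "\<And>y k. y \<noteq> 0 \<Longrightarrow> ((\<lambda>y. G y k) has_derivative (\<lambda>h. G' y (case_nat h k))) (at y)"
    by blast
  let ?H = "\<lambda>y k. F y (\<lambda>i. k (Suc i)) * G' y k + F' y k * G y (\<lambda>i. k (Suc i))"
  have "contraction_field B (Suc p) ?H"
    using mult.hyps F' G'
    by (intro contraction_field.add contraction_field.mult contraction_field_shift)
  moreover have "((\<lambda>y. F y k * G y k) has_derivative (\<lambda>h. ?H y (case_nat h k))) (at y)"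
    if "y \<noteq> 0" for y k
    using has_derivative_mult[OF dF[OF that] dG[OF that]] by simp
  ultimately show ?case by (intro exI[of _ ?H]) blast
qed

lemma contraction_field_bounded:
  fixes B :: "'a::euclidean_space \<Rightarrow> ('a \<Rightarrow>\<^sub>L real)"
  assumes B: "selfadjoint_posdef B" and "contraction_field B p F"
  shows "\<exists>M. \<forall>k. (\<forall>i<p. normB B (k i) = 1) \<longrightarrow> \<bar>F y k\<bar> \<le> M"
  using assms(2)
proof induction
  case (point i)
  then show ?case
    by (intro exI[of _ "normB B y"]) (auto intro: abs_pairing_le_normB[OF B])
next
  case (pair i j)
  have "\<bar>blinfun_apply (B (k i)) (k j)\<bar> \<le> 1" if "\<forall>i<p. normB B (k i) = 1" for k
    using abs_pairing_le_normB[OF B, of "k j" "k i"] that pair by simp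
  then show ?case by blast
next
  case (add F G)
  then obtain M N where
    "\<And>k. \<forall>i<p. normB B (k i) = 1 \<Longrightarrow> \<bar>F y k\<bar> \<le> M"
    "\<And>k. \<forall>i<p. normB B (k i) = 1 \<Longrightarrow> \<bar>G y k\<bar> \<le> N" by blast
  then show ?case
    by (intro exI[of _ "M + N"]) (meson abs_triangle_ineq add_mono order_trans)
next
  case (mult F G)
  then obtain M N where
    "\<And>k. \<forall>i<p. normB B (k i) = 1 \<Longrightarrow> \<bar>F y k\<bar> \<le> M"
    "\<And>k. \<forall>i<p. normB B (k i) = 1 \<Longrightarrow> \<bar>G y k\<bar> \<le> N" by blast
  then have "\<bar>F y k * G y k\<bar> \<le> M * N" if "\<forall>i<p. normB B (k i) = 1" for k
    using that by (simp add: abs_mult mult_mono')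
  then show ?case by blast
qed auto

lemma power_norm_eq_powr:
  assumes "selfadjoint_posdef B"
  shows "power_norm B q x = blinfun_apply (B x) x powr (q / 2)"
  using posdef_nonneg[OF assms, of x]
  by (simp add: power_norm_def normB_def powr_half_sqrt[symmetric] powr_powr)

lemma Dform_power_norm_contraction_field:
  fixes B :: "'a::euclidean_space \<Rightarrow> ('a \<Rightarrow>\<^sub>L real)"
  assumes B: "selfadjoint_posdef B"
  shows "\<exists>F. contraction_field B p F \<and>
    (\<forall>y hs. y \<noteq> 0 \<longrightarrow> length hs = p \<longrightarrow> Dform (power_norm B q) y hs = F y (nth hs))"
proof (induction p)
  case 0
  show ?case
    using power_norm_eq_powr[OF B]
    by (intro exI[of _ "\<lambda>y k. blinfun_apply (B y) y powr (q / 2)"])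
      (auto intro: contraction_field.power)
next
  case (Suc p)
  then obtain F where F: "contraction_field B p F" and
    DF: "\<And>y hs. y \<noteq> 0 \<Longrightarrow> length hs = p \<Longrightarrow> Dform (power_norm B q) y hs = F y (nth hs)"
    by blast
  obtain F' where F': "contraction_field B (Suc p) F'" and
    dF: "\<And>y k. y \<noteq> 0 \<Longrightarrow> ((\<lambda>y. F y k) has_derivative (\<lambda>h. F' y (case_nat h k))) (at y)"
    using contraction_field_derivative[OF B F] by blast
  have "Dform (power_norm B q) y (h # hs) = F' y (nth (h # hs))"
    if y: "y \<noteq> 0" and hs: "length hs = p" for y h hs
  proof -
    have "((\<lambda>y. Dform (power_norm B q) y hs) has_derivative
        (\<lambda>h. F' y (case_nat h (nth hs)))) (at y)"
      by (rule has_derivative_transform_within_open[OF dF[OF y], of "- {0}"])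
        (use y hs DF in auto)
    then have "frechet_derivative (\<lambda>y. Dform (power_norm B q) y hs) (at y)
        = (\<lambda>h. F' y (case_nat h (nth hs)))"
      by (rule frechet_derivative_at[symmetric])
    moreover have "nth (h # hs) = case_nat h (nth hs)"
      by (simp add: fun_eq_iff nth_Cons)
    ultimately show ?thesis by simp
  qed
  then show ?case using F' by (intro exI[of _ F']) (auto simp: length_Suc_conv)
qed

lemma Dform_power_norm_differentiable:
  fixes B :: "'a::euclidean_space \<Rightarrow> ('a \<Rightarrow>\<^sub>L real)"
  assumes B: "selfadjoint_posdef B" and y: "y \<noteq> 0"
  shows "(\<lambda>y. Dform (power_norm B q) y hs) differentiable (at y)"
proof -
  obtain F where F: "contraction_field B (length hs) F" and
    DF: "\<And>y. y \<noteq> 0 \<Longrightarrow> Dform (power_norm B q) y hs = F y (nth hs)"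
    using Dform_power_norm_contraction_field[OF B, of "length hs" q] by blast
  obtain F' where
    "((\<lambda>y. F y (nth hs)) has_derivative (\<lambda>h. F' y (case_nat h (nth hs)))) (at y)"
    using contraction_field_derivative[OF B F] y by blast
  then have "((\<lambda>y. Dform (power_norm B q) y hs) has_derivative
        (\<lambda>h. F' y (case_nat h (nth hs)))) (at y)"
    by (rule has_derivative_transform_within_open[of _ _ _ _ "- {0}"]) (use y DF in auto)
  then show ?thesis by (rule differentiableI)
qed

lemma times_differentiable_power_norm:
  fixes B :: "'a::euclidean_space \<Rightarrow> ('a \<Rightarrow>\<^sub>L real)"
  assumes B: "selfadjoint_posdef B" and "y \<noteq> 0"
  shows "times_differentiable_at p (power_norm B q) y"
  using assms(2)
proof (induction p arbitrary: y)
  case (Suc p)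
  have "\<forall>\<^sub>F z in nhds y. z \<in> - {0}"
    using Suc.prems by (intro eventually_nhds_in_open) auto
  then have "\<forall>\<^sub>F z in nhds y. times_differentiable_at p (power_norm B q) z"
    by (rule eventually_mono) (simp add: Suc.IH)
  then show ?case
    using Dform_power_norm_differentiable[OF B Suc.prems] by simp
qed simp

section \<open>Derivatives along a line\<close>

text \<open>
  The sign \<open>s = 1\<close> or \<open>s = -1\<close> selects a half-line, parametrised by \<open>t > 0\<close>. The directions
  \<open>e\<close> stay the same on both, so every differentiation with respect to \<open>t\<close> contributes a factor
  \<open>s\<close>; this is where the parity of \<open>p\<close> enters.
\<close>

lemma Dform_power_norm_line:
  fixes B :: "'a::euclidean_space \<Rightarrow> ('a \<Rightarrow>\<^sub>L real)"
  assumes B: "selfadjoint_posdef B" and e: "normB B e = 1" and s: "\<bar>s\<bar> = 1" and "t > 0"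
  shows "Dform (power_norm B q) ((t * s) *\<^sub>R e) (replicate p e)
    = s ^ p * (\<Prod>i<p. q - real i) * t powr (q - real p)"
  using \<open>t > 0\<close>
proof (induction p arbitrary: t)
  case 0
  then show ?case using s e
    by (simp add: power_norm_def normB_scaleR[OF B] abs_mult)
next
  case (Suc p)
  define D where "D = (\<lambda>y. Dform (power_norm B q) y (replicate p e))"
  define c where "c = s ^ p * (\<Prod>i<p. q - real i)"
  have "e \<noteq> 0" using e normB_scaleR[OF B, of 0 0] by auto
  then have "(t * s) *\<^sub>R e \<noteq> 0" using Suc.prems s by auto
  then have "(D has_derivative frechet_derivative D (at ((t * s) *\<^sub>R e))) (at ((t * s) *\<^sub>R e))"
    unfolding D_def frechet_derivative_works[symmetric]
    by (rule Dform_power_norm_differentiable[OF B])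
  moreover have "((\<lambda>r. (r * s) *\<^sub>R e) has_derivative (\<lambda>r. (r * s) *\<^sub>R e)) (at t)"
    by (auto intro!: derivative_eq_intros)
  ultimately have "((\<lambda>r. D ((r * s) *\<^sub>R e)) has_derivative
      (\<lambda>r. frechet_derivative D (at ((t * s) *\<^sub>R e)) ((r * s) *\<^sub>R e))) (at t)"
    by (rule has_derivative_compose[rotated])
  moreover have "((\<lambda>r. D ((r * s) *\<^sub>R e)) has_derivative
      (\<lambda>r. r * (c * ((q - real p) * t powr (q - real p - 1))))) (at t)"
  proof (rule has_derivative_transform_within_open[of "\<lambda>r. c * r powr (q - real p)" _ _ _ "{0<..}"])
    have "((\<lambda>r. c * r powr (q - real p)) has_real_derivative
        c * ((q - real p) * t powr (q - real p - 1))) (at t)"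
      by (intro DERIV_cmult has_real_derivative_powr Suc.prems)
    then show "((\<lambda>r. c * r powr (q - real p)) has_derivative
        (\<lambda>r. r * (c * ((q - real p) * t powr (q - real p - 1))))) (at t)"
      unfolding has_field_derivative_def
      by (rule has_derivative_eq_rhs) (simp add: fun_eq_iff mult.commute)
  qed (use Suc in \<open>auto simp: D_def c_def\<close>)
  ultimately have "(\<lambda>r. frechet_derivative D (at ((t * s) *\<^sub>R e)) ((r * s) *\<^sub>R e))
      = (\<lambda>r. r * (c * ((q - real p) * t powr (q - real p - 1))))"
    by (rule has_derivative_unique)
  \<comment> \<open>The half-line has velocity \<open>s e\<close>; scaling it by \<open>r = s\<close> gives the direction \<open>e\<close>.\<close>
  from fun_cong[OF this, of s]
  have "frechet_derivative D (at ((t * s) *\<^sub>R e)) e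
      = s * (c * ((q - real p) * t powr (q - real p - 1)))"
    using s by (simp add: abs_mult_self_eq[of s, symmetric])
  then show ?case
    by (simp add: D_def c_def mult_ac diff_diff_eq add.commute)
qed

lemma prod_diff_eq_prod_add:
  fixes x :: real
  shows "(\<Prod>i<p. real p + x - real i) = (\<Prod>i=1..p. x + real i)"
  by (rule prod.reindex_bij_witness[of _ "\<lambda>i. p - i" "\<lambda>i. p - i"]) (auto simp: of_nat_diff)

section \<open>The lower bound\<close>

lemma abs_le_form_norm:
  assumes "\<And>hs. length hs = p \<Longrightarrow> \<forall>h\<in>set hs. normB B h = 1 \<Longrightarrow> \<bar>L hs\<bar> \<le> M"
    and "normB B e = 1"
  shows "\<bar>L (replicate p e)\<bar> \<le> form_norm B p L"
  unfolding form_norm_def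
proof (rule cSup_upper)
  show "bdd_above {\<bar>L hs\<bar> |hs. length hs = p \<and> (\<forall>h\<in>set hs. normB B h = 1)}"
    using assms(1) by (auto intro!: bdd_aboveI[of _ M])
qed (use assms(2) in \<open>auto intro!: exI[of _ "replicate p e"]\<close>)

lemma Dform_power_norm_bounded:
  fixes B :: "'a::euclidean_space \<Rightarrow> ('a \<Rightarrow>\<^sub>L real)"
  assumes B: "selfadjoint_posdef B" and "y \<noteq> 0"
  obtains M where "\<And>hs. length hs = p \<Longrightarrow> \<forall>h\<in>set hs. normB B h = 1 \<Longrightarrow>
    \<bar>Dform (power_norm B q) y hs\<bar> \<le> M"
proof -
  obtain F where F: "contraction_field B p F" and
    DF: "\<And>hs. length hs = p \<Longrightarrow> Dform (power_norm B q) y hs = F y (nth hs)"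
    using Dform_power_norm_contraction_field[OF B, of p q] \<open>y \<noteq> 0\<close> by blast
  obtain M where M: "\<And>k. \<forall>i<p. normB B (k i) = 1 \<Longrightarrow> \<bar>F y k\<bar> \<le> M"
    using contraction_field_bounded[OF B F, of y] by blast
  show ?thesis
    by (rule that[of M]) (use M DF in \<open>auto simp: nth_mem\<close>)
qed

lemma holder_bound_on_line:
  fixes B :: "'a::euclidean_space \<Rightarrow> ('a \<Rightarrow>\<^sub>L real)"
  assumes B: "selfadjoint_posdef B" and e: "normB B e = 1"
    and H: "holder_bound B p \<nu> (power_norm B q) A"
    and x: "x1 \<noteq> 0" "x2 \<noteq> 0"
  shows "\<bar>Dform (power_norm B q) x2 (replicate p e) - Dform (power_norm B q) x1 (replicate p e)\<bar>
    \<le> A * normB B (x2 - x1) powr \<nu>"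
proof -
  let ?L = "\<lambda>hs. Dform (power_norm B q) x2 hs - Dform (power_norm B q) x1 hs"
  obtain M where M: "\<And>hs. length hs = p \<Longrightarrow> \<forall>h\<in>set hs. normB B h = 1 \<Longrightarrow>
      \<bar>Dform (power_norm B q) x1 hs\<bar> \<le> M"
    using Dform_power_norm_bounded[OF B x(1)] by blast
  obtain N where N: "\<And>hs. length hs = p \<Longrightarrow> \<forall>h\<in>set hs. normB B h = 1 \<Longrightarrow>
      \<bar>Dform (power_norm B q) x2 hs\<bar> \<le> N"
    using Dform_power_norm_bounded[OF B x(2)] by blast
  have "\<bar>?L hs\<bar> \<le> N + M" if "length hs = p" "\<forall>h\<in>set hs. normB B h = 1" for hs
    using M[OF that] N[OF that] by linarith
  then have "\<bar>?L (replicate p e)\<bar> \<le> form_norm B p ?L"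
    using e by (rule abs_le_form_norm)
  also have "\<dots> \<le> A * normB B (x2 - x1) powr \<nu>"
    using H times_differentiable_power_norm[OF B] x by (simp add: holder_bound_def)
  finally show ?thesis .
qed

theorem theorem6p1:
  fixes B :: "'a::euclidean_space \<Rightarrow> ('a \<Rightarrow>\<^sub>L real)"
    and p :: nat and \<nu> A :: real
  assumes "selfadjoint_posdef B"
    and "0 \<le> \<nu>" and "\<nu> \<le> 1"
    and "\<nu> = 0 \<Longrightarrow> odd p \<or> p = 0"
    and "holder_bound B p \<nu> (power_norm B (real p + \<nu>)) A"
  shows "A \<ge> C_const p \<nu>"
proof -
  note B = assms(1)
  obtain e where e: "normB B e = 1" using exists_unit_vector[OF B] .
  have e0: "e \<noteq> 0" using e normB_scaleR[OF B, of 0 0] by auto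
  define C where "C = (\<Prod>i=1..p. \<nu> + real i)"
  have C: "C \<ge> 0" unfolding C_def using assms(2) by (intro prod_nonneg) auto
  have D: "Dform (power_norm B (real p + \<nu>)) ((t * s) *\<^sub>R e) (replicate p e)
      = s ^ p * C * t powr \<nu>" if "\<bar>s\<bar> = 1" "t > 0" for s t
    using Dform_power_norm_line[OF B e that, of "real p + \<nu>" p]
    by (simp add: C_def prod_diff_eq_prod_add)
  note line = holder_bound_on_line[OF B e assms(5)]
  consider (odd) "odd p" | (even) "even p" "\<nu> > 0" | (zero) "p = 0" "\<nu> = 0"
    using assms(2,4) by fastforce
  then show ?thesis
  proof cases
    case odd
    have "\<bar>C - (- C)\<bar> \<le> A * normB B (2 *\<^sub>R e) powr \<nu>"
      using line[of "- e" e] e0 D[of 1 1] D[of "-1" 1] odd by (simp add: scaleR_2)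
    then have "2 * C \<le> A * 2 powr \<nu>"
      using e C by (simp add: normB_scaleR[OF B])
    then have "2 * C / 2 powr \<nu> \<le> A" by (simp add: field_simps)
    then show ?thesis
      using odd by (simp add: C_const_def C_def powr_diff)
  next
    case even
    have "C * (1 - \<epsilon> powr \<nu>) \<le> A * (1 - \<epsilon>) powr \<nu>" if \<epsilon>: "0 < \<epsilon>" "\<epsilon> < 1" for \<epsilon> :: real
    proof -
      have "e - \<epsilon> *\<^sub>R e = (1 - \<epsilon>) *\<^sub>R e" by (simp add: scaleR_left_diff_distrib)
      then have "\<bar>C - C * \<epsilon> powr \<nu>\<bar> \<le> A * (1 - \<epsilon>) powr \<nu>"
        using line[of "\<epsilon> *\<^sub>R e" e] e0 e D[of 1 1] D[of 1 \<epsilon>] \<epsilon> by (simp add: normB_scaleR[OF B])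
      then show ?thesis by (simp add: right_diff_distrib)
    qed
    then have "\<forall>\<^sub>F \<epsilon> in at_right 0. C * (1 - \<epsilon> powr \<nu>) \<le> A * (1 - \<epsilon>) powr \<nu>"
      by (auto simp: eventually_at_right_field intro!: exI[of _ 1])
    moreover have "((\<lambda>\<epsilon>. \<epsilon> powr \<nu>) \<longlongrightarrow> 0) (at_right 0)"
      using even(2) by (intro tendsto_eq_intros | auto simp: eventually_at_right_field intro!: exI[of _ 1])+
    then have "((\<lambda>\<epsilon>. C * (1 - \<epsilon> powr \<nu>)) \<longlongrightarrow> C * (1 - 0)) (at_right 0)"
      by (intro tendsto_intros)
    moreover have "((\<lambda>\<epsilon>. A * (1 - \<epsilon>) powr \<nu>) \<longlongrightarrow> A * (1 - 0) powr \<nu>) (at_right 0)"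
      by (intro tendsto_intros) auto
    ultimately have "C * (1 - 0) \<le> A * (1 - 0) powr \<nu>"
      by (intro tendsto_le[OF trivial_limit_at_right_real])
    then show ?thesis using even by (simp add: C_const_def C_def)
  next
    \<comment> \<open>Here the function is \<open>0\<close> at the origin and \<open>1\<close> elsewhere, so the limit above carries no
      information and the origin itself serves as the test point.\<close>
    case zero
    have "form_norm B 0 (\<lambda>hs. Dform (power_norm B 0) e hs - Dform (power_norm B 0) 0 hs)
        \<le> A * normB B (e - 0) powr 0"
      using assms(5) zero unfolding holder_bound_def by (metis add_0 of_nat_0 times_differentiable_at.simps(1))
    then have "1 \<le> A"
      using e normB_scaleR[OF B, of 0 0] by (simp add: form_norm_def power_norm_def)
    then show ?thesis using zero by (simp add: C_const_def)
  qed
qed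

end
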